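(* Let $X$ be a set and let $\mathcal{S}$ be an indecomposable matrix-like semigroup of nonnegative functions on $X \times X$. If there exist $u, v \in X$ such that $\sup \{ f(u,v) : f \in \mathcal{S} \} < \infty$, then there exists a function $d : X \to (0, \infty)$ such that $$ f(x, y) \le \frac{d(x)}{d(y)} $$ for all $f \in \mathcal{S}$ and all $x, y \in X$.
   Context: A set $\mathcal{S}$ of nonnegative real-valued functions on $X \times X$, closed under a given associative operation $*$, is called a matrix-like semigroup if $(f*g)(x,z) \ge f(x,y)\, g(y,z)$ for all $f, g \in \mathcal{S}$ and all $x, y, z \in X$. A set $\mathcal{S}$ of nonnegative functions on $X \times X$ is indecomposable if for every $x, y \in X$ there exists $f \in \mathcal{S}$ such that $f(x,y) > 0$. *)

theory Defs
  imports "HOL-Library.FuncSet" "HOL-Library.Extended_Real"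
begin

text \<open>
  Functions on \<open>X \<times> X\<close> are extensional, so that two of them are equal as HOL functions exactly
  if they agree on \<open>X \<times> X\<close>.
\<close>

definition nonneg_functions :: "'a set \<Rightarrow> ('a \<times> 'a \<Rightarrow> real) set" where
  "nonneg_functions X = X \<times> X \<rightarrow>\<^sub>E {0..}"

text \<open>
  The operation \<open>star\<close> is arbitrary; it is only relevant on \<open>S\<close>, where it has to be closed
  and associative.
\<close>

definition matrix_like_semigroup ::
  "'a set \<Rightarrow> ('a \<times> 'a \<Rightarrow> real) set
    \<Rightarrow> (('a \<times> 'a \<Rightarrow> real) \<Rightarrow> ('a \<times> 'a \<Rightarrow> real) \<Rightarrow> ('a \<times> 'a \<Rightarrow> real)) \<Rightarrow> bool" where
  "matrix_like_semigroup X S star \<longleftrightarrow>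
     S \<subseteq> nonneg_functions X \<and>
     (\<forall>f\<in>S. \<forall>g\<in>S. star f g \<in> S) \<and>
     (\<forall>f\<in>S. \<forall>g\<in>S. \<forall>h\<in>S. star (star f g) h = star f (star g h)) \<and>
     (\<forall>f\<in>S. \<forall>g\<in>S. \<forall>x\<in>X. \<forall>y\<in>X. \<forall>z\<in>X. star f g (x, z) \<ge> f (x, y) * g (y, z))"

definition indecomposable :: "'a set \<Rightarrow> ('a \<times> 'a \<Rightarrow> real) set \<Rightarrow> bool" where
  "indecomposable X S \<longleftrightarrow> (\<forall>x\<in>X. \<forall>y\<in>X. \<exists>f\<in>S. f (x, y) > 0)"

end

theory Submission
  imports Defs
begin

text \<open>
  Take \<open>d x = sup {f (x, v) | f \<in> S}\<close>. It is finite because \<open>g (u, x) * f (x, v) \<le> star g f (u, v)\<close>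
  for some \<open>g\<close> with \<open>g (u, x) > 0\<close>, positive by indecomposability, and the supremum over \<open>h\<close> of
  \<open>f (x, y) * h (y, v) \<le> star f h (x, v) \<le> d x\<close> gives \<open>f (x, y) * d y \<le> d x\<close>.
\<close>

theorem theorem2p7:
  fixes X :: "'a set"
    and S :: "('a \<times> 'a \<Rightarrow> real) set"
    and star :: "('a \<times> 'a \<Rightarrow> real) \<Rightarrow> ('a \<times> 'a \<Rightarrow> real) \<Rightarrow> ('a \<times> 'a \<Rightarrow> real)"
  assumes "matrix_like_semigroup X S star"
    and "indecomposable X S"
    and "\<exists>u\<in>X. \<exists>v\<in>X. (SUP f\<in>S. ereal (f (u, v))) < \<infinity>"
  shows "\<exists>d \<in> X \<rightarrow> {0 :: real <..}. \<forall>f\<in>S. \<forall>x\<in>X. \<forall>y\<in>X. f (x, y) \<le> d x / d y"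
proof -
  have closed: "star f g \<in> S" if "f \<in> S" "g \<in> S" for f g
    using assms(1) that unfolding matrix_like_semigroup_def by blast
  have mult: "f (x, y) * g (y, z) \<le> star f g (x, z)"
    if "f \<in> S" "g \<in> S" "x \<in> X" "y \<in> X" "z \<in> X" for f g x y z
    using assms(1) that unfolding matrix_like_semigroup_def by blast
  have nonneg: "0 \<le> f (x, y)" if "f \<in> S" "x \<in> X" "y \<in> X" for f x y
  proof -
    have "f \<in> X \<times> X \<rightarrow>\<^sub>E {0..}"
      using assms(1) that(1) unfolding matrix_like_semigroup_def nonneg_functions_def by blast
    then have "f (x, y) \<in> {0..}"
      by (rule PiE_mem) (simp add: that)
    then show ?thesis
      by simp
  qed
  have pos: "\<exists>f\<in>S. 0 < f (x, y)" if "x \<in> X" "y \<in> X" for x y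
    using assms(2) that unfolding indecomposable_def by blast
  obtain u v where u: "u \<in> X" and v: "v \<in> X"
    and fin: "(SUP f\<in>S. ereal (f (u, v))) < \<infinity>"
    using assms(3) by blast
  \<comment> \<open>Density of the reals in \<open>ereal\<close> turns finiteness of the extended
    supremum into a real bound \<open>M\<close>, so that the rest is arithmetic in
    \<open>real\<close>.\<close>
  obtain M where "(SUP f\<in>S. ereal (f (u, v))) < ereal M"
    using ereal_dense2[OF fin] by blast
  then have M: "f (u, v) \<le> M" if "f \<in> S" for f
    using SUP_lessD[OF _ that] by (metis ereal_less_eq(3) less_imp_le)
  \<comment> \<open>This supremum is taken in \<open>real\<close>, where it is only meaningful for a
    bounded nonempty family; hence \<open>bdd\<close> comes before any estimate on
    \<open>d\<close>.\<close>
  define d where "d x = (SUP f\<in>S. f (x, v))" for x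
  have bdd: "bdd_above ((\<lambda>f. f (x, v)) ` S)" if x: "x \<in> X" for x
  proof -
    obtain g where g: "g \<in> S" "0 < g (u, x)"
      using pos[OF u x] by blast
    have "f (x, v) \<le> M / g (u, x)" if f: "f \<in> S" for f
      using mult[OF g(1) f u x v] M[OF closed[OF g(1) f]] g(2)
      by (simp add: pos_le_divide_eq mult.commute)
    then show ?thesis
      by (rule bdd_aboveI2)
  qed
  have upper: "f (x, v) \<le> d x" if "f \<in> S" "x \<in> X" for f x
    unfolding d_def by (rule cSUP_upper[OF that(1) bdd[OF that(2)]])
  have d_pos: "0 < d x" if x: "x \<in> X" for x
    using pos[OF x v] upper[OF _ x] by (blast intro: less_le_trans)
  \<comment> \<open>Division by \<open>f (x, y)\<close> makes the product inequality a bound on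
    \<open>h (y, v)\<close> uniform in \<open>h\<close>; the value 0 is split off, where positivity
    of \<open>d\<close> suffices.\<close>
  have "f (x, y) \<le> d x / d y" if f: "f \<in> S" and x: "x \<in> X" and y: "y \<in> X" for f x y
  proof (cases "f (x, y) = 0")
    case True
    then show ?thesis
      using d_pos[OF x] d_pos[OF y] by simp
  next
    case False
    then have fpos: "0 < f (x, y)"
      using nonneg[OF f x y] by simp
    have "h (y, v) \<le> d x / f (x, y)" if h: "h \<in> S" for h
      using mult[OF f h x y v] upper[OF closed[OF f h] x] fpos
      by (simp add: pos_le_divide_eq mult.commute)
    \<comment> \<open>\<open>f\<close> itself witnesses that \<open>S\<close> is nonempty, which
      \<open>cSUP_least\<close> requires.\<close>
    then have "d y \<le> d x / f (x, y)"
      unfolding d_def[of y] using f by (intro cSUP_least) auto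
    then show ?thesis
      using fpos d_pos[OF y] by (simp add: pos_le_divide_eq mult.commute)
  qed
  then show ?thesis
    using d_pos by (intro bexI[of _ d]) auto
qed

end
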